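(* Let $(\boldsymbol s,\boldsymbol t)$ be a bipartite degree sequence, $L_0,Y\subseteq K_{m,n}$ with $L_0\cap Y=\boldsymbol{\emptyset}$, let $\{\bar e_j\}_{j=1}^{m(Y)}$ enumerate the edges of $Y$ with $\bar e_j=p_jq_j$, $p_j\in S$, $q_j\in T$, and set $L_j=L_0+\bar e_1+\dots+\bar e_j$. Let $G\sim\mathcal B_{(\boldsymbol s,\boldsymbol t)}(\boldsymbol{\emptyset},L_0)$. (A) If $q(\boldsymbol s,\boldsymbol t,\boldsymbol{\emptyset},L_{j-1},\bar e_j)>0$ for all $j$, then $$\mathbb P(Y\cap G=\boldsymbol{\emptyset})\le\prod_{j=1}^{m(Y)}\left(1+\frac{s_{p_j}t_{q_j}}{m(G)}\right)^{-1}\cdot\prod_{j=1}^{m(Y)}\frac{1}{q(\boldsymbol s,\boldsymbol t,\boldsymbol{\emptyset},L_{j-1},\bar e_j)}.$$ (B) If $p(\boldsymbol s,\boldsymbol t,\boldsymbol{\emptyset},L_{j-1},\bar e_j)>0$ for all $j$, then $$\mathbb P(Y\cap G=\boldsymbol{\emptyset})\ge\prod_{j=1}^{m(Y)}\left(1+\frac{s_{p_j}t_{q_j}}{m(G)}\right)^{-1}\cdot\prod_{j=1}^{m(Y)}p(\boldsymbol s,\boldsymbol t,\boldsymbol{\emptyset},L_{j-1},\bar e_j).$$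
   Context: $K_{m,n}$ is the complete bipartite graph with parts $S=\{u_1,\dots,u_m\}$, $T=\{v_1,\dots,v_n\}$; edges $uv$ have $u\in S$, $v\in T$; graphs are subgraphs identified with edge sets, $\boldsymbol\emptyset$ the edgeless graph, $m(\cdot)$ the number of edges, $H+e$ adds edge $e$. Degree sequences $(\boldsymbol a,\boldsymbol b)$ have $\boldsymbol a$ indexed by $S$, $\boldsymbol b$ by $T$; a graph $H$ has $(\boldsymbol h,\boldsymbol i)$, a graph $L$ has $(\boldsymbol l,\boldsymbol m)$ (bold $\boldsymbol m$ a vector on $T$). $\mathcal B_{(\boldsymbol s,\boldsymbol t)}(X,Y)$ is the (assumed nonempty) set of $G\subseteq K_{m,n}$ with degree sequence $(\boldsymbol s,\boldsymbol t)$, $X\subseteq G$, $G\cap Y=\boldsymbol\emptyset$, uniformly distributed; $m(G):=\sum_{u\in S}s_u$. Degree sum function: for a nonnegative integer vector $\boldsymbol g$ on a finite set with sorted entries $g_{i_1}\ge\dots\ge g_{i_N}$, $L(\boldsymbol g,k)=\sum_{j\le k}g_{i_j}$, $D(\boldsymbol g,x)=g_{i_1}x$ ($x<1$), $g_{i_{k+1}}(x-k)+L(\boldsymbol g,k)$ ($x\in[k,k+1)$, $1\le k\le N-1$), $L(\boldsymbol g,N)$ ($x\ge N$). $S_H(x)=D(\boldsymbol s-\boldsymbol h,x)$, $T_H(x)=D(\boldsymbol t-\boldsymbol i,x)$. $\alpha_w(\boldsymbol n,\boldsymbol l,\boldsymbol g,\boldsymbol h)=D(\boldsymbol n+\boldsymbol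 l,\max\{g_w-h_w,1\})/\max\{g_w-h_w,1\}$. For $H\cap L=\boldsymbol\emptyset$, $uv\notin H\cup L$, $L$ with degree sequence $(\boldsymbol l,\boldsymbol m)$: $p(\boldsymbol s,\boldsymbol t,H,L,uv)=1-\dfrac{T_H(s_u+l_u)+S_H(t_v+m_v)}{m(G)-m(H)}$, $q(\boldsymbol s,\boldsymbol t,H,L,uv)=1-\dfrac{S_H(\alpha_u(\boldsymbol t,\boldsymbol m,\boldsymbol s,\boldsymbol h))+T_H(\alpha_v(\boldsymbol s,\boldsymbol l,\boldsymbol t,\boldsymbol i))}{m(G)-m(H)}$ (here $H=\boldsymbol\emptyset$, $(\boldsymbol h,\boldsymbol i)=(\mathbf 0,\mathbf 0)$, and $L=L_{j-1}$). *)

theory Defs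
  imports "HOL-Probability.Probability_Mass_Function" "HOL-Library.Multiset"
begin

text \<open>
  The complete bipartite graph with finite parts \<open>S :: 'a set\<close> and \<open>T :: 'b set\<close> is the edge set
  \<open>S \<times> T\<close>; a bipartite graph is a set of edges \<open>(u, v)\<close>, contained in \<open>S \<times> T\<close>.
  Vectors indexed by a part are functions of which only the values on that part matter.
\<close>

definition ldeg :: "('a \<times> 'b) set \<Rightarrow> 'a \<Rightarrow> nat" where
  "ldeg G u = card {v. (u, v) \<in> G}"

definition rdeg :: "('a \<times> 'b) set \<Rightarrow> 'b \<Rightarrow> nat" where
  "rdeg G v = card {u. (u, v) \<in> G}"

definition has_degrees ::
  "'a set \<Rightarrow> 'b set \<Rightarrow> ('a \<Rightarrow> nat) \<Rightarrow> ('b \<Rightarrow> nat) \<Rightarrow> ('a \<times> 'b) set \<Rightarrow> bool" where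
  "has_degrees S T s t G \<longleftrightarrow>
     G \<subseteq> S \<times> T \<and> (\<forall>u\<in>S. ldeg G u = s u) \<and> (\<forall>v\<in>T. rdeg G v = t v)"

definition bip_degree_seq :: "'a set \<Rightarrow> 'b set \<Rightarrow> ('a \<Rightarrow> nat) \<Rightarrow> ('b \<Rightarrow> nat) \<Rightarrow> bool" where
  "bip_degree_seq S T s t \<longleftrightarrow> (\<exists>G. has_degrees S T s t G)"

definition bip_graphs ::
  "'a set \<Rightarrow> 'b set \<Rightarrow> ('a \<Rightarrow> nat) \<Rightarrow> ('b \<Rightarrow> nat) \<Rightarrow> ('a \<times> 'b) set \<Rightarrow> ('a \<times> 'b) set
     \<Rightarrow> ('a \<times> 'b) set set" where
  "bip_graphs S T s t X Y = {G. has_degrees S T s t G \<and> X \<subseteq> G \<and> G \<inter> Y = {}}"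

text \<open>The entries of \<open>g\<close> on \<open>A\<close>, with repetitions, in non-increasing order
  (indexed from \<open>0\<close>).\<close>

definition sorted_entries :: "'c set \<Rightarrow> ('c \<Rightarrow> nat) \<Rightarrow> nat list" where
  "sorted_entries A g = rev (sorted_list_of_multiset (image_mset g (mset_set A)))"

definition top_sum :: "'c set \<Rightarrow> ('c \<Rightarrow> nat) \<Rightarrow> nat \<Rightarrow> nat" where
  "top_sum A g k = sum_list (take k (sorted_entries A g))"

definition deg_sum :: "'c set \<Rightarrow> ('c \<Rightarrow> nat) \<Rightarrow> real \<Rightarrow> real" where
  "deg_sum A g x =
     (if x < 1 then real (sorted_entries A g ! 0) * x
      else if x < real (card A) then
        (let k = nat \<lfloor>x\<rfloor> in
           real (sorted_entries A g ! k) * (x - real k) + real (top_sum A g k))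
      else real (top_sum A g (card A)))"

text \<open>The differences \<open>s u - ldeg H u\<close>, \<open>t v - rdeg H v\<close>, \<open>g w - h w\<close> below are those of natural
  numbers; they are the true differences whenever \<open>H\<close> is contained in a graph with degree
  sequence \<open>(s, t)\<close>.\<close>

definition S_sum :: "'a set \<Rightarrow> ('a \<Rightarrow> nat) \<Rightarrow> ('a \<times> 'b) set \<Rightarrow> real \<Rightarrow> real" where
  "S_sum S s H x = deg_sum S (\<lambda>u. s u - ldeg H u) x"

definition T_sum :: "'b set \<Rightarrow> ('b \<Rightarrow> nat) \<Rightarrow> ('a \<times> 'b) set \<Rightarrow> real \<Rightarrow> real" where
  "T_sum T t H x = deg_sum T (\<lambda>v. t v - rdeg H v) x"

text \<open>Here \<open>n\<close>, \<open>l\<close> are vectors on the part \<open>A\<close>, while \<open>g\<close>, \<open>h\<close> are vectors on the part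
  containing \<open>w\<close>.\<close>

definition alpha ::
  "'c set \<Rightarrow> ('c \<Rightarrow> nat) \<Rightarrow> ('c \<Rightarrow> nat) \<Rightarrow> ('d \<Rightarrow> nat) \<Rightarrow> ('d \<Rightarrow> nat) \<Rightarrow> 'd \<Rightarrow> real" where
  "alpha A n l g h w =
     deg_sum A (\<lambda>x. n x + l x) (real (max (g w - h w) 1)) / real (max (g w - h w) 1)"

definition p_bound ::
  "'a set \<Rightarrow> 'b set \<Rightarrow> ('a \<Rightarrow> nat) \<Rightarrow> ('b \<Rightarrow> nat) \<Rightarrow> ('a \<times> 'b) set \<Rightarrow> ('a \<times> 'b) set
     \<Rightarrow> 'a \<times> 'b \<Rightarrow> real" where
  "p_bound S T s t H L e = (case e of (u, v) \<Rightarrow>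
     1 - (T_sum T t H (real (s u + ldeg L u)) + S_sum S s H (real (t v + rdeg L v)))
         / (real (\<Sum>u\<in>S. s u) - real (card H)))"

definition q_bound ::
  "'a set \<Rightarrow> 'b set \<Rightarrow> ('a \<Rightarrow> nat) \<Rightarrow> ('b \<Rightarrow> nat) \<Rightarrow> ('a \<times> 'b) set \<Rightarrow> ('a \<times> 'b) set
     \<Rightarrow> 'a \<times> 'b \<Rightarrow> real" where
  "q_bound S T s t H L e = (case e of (u, v) \<Rightarrow>
     1 - (S_sum S s H (alpha T t (rdeg L) s (ldeg H) u)
          + T_sum T t H (alpha S s (ldeg L) t (rdeg H) v))
         / (real (\<Sum>u\<in>S. s u) - real (card H)))"

end

(*
  Forbid the edges of Y one at a time and compare, at each step, the graphs that contain the next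
  edge uv with those that do not. Replacing uv, xy by uy, xv leads from the former to the latter:
  each source graph has at least m(G) p such switchings and each result arises from at most s_u t_v
  of them, which gives (B). For (A), replacing uy, xv, x'y' by uv, x'y, xy' leads back: concavity of
  the degree sum function gives at least s_u t_v m(G) q choices, and the two new edges x'y, xy'
  determine the switching, so each result arises at most m(G)^2 times. As p, q <= 1, these ratios
  yield the stated factors.
*)
theory Submission
  imports Defs
begin

section \<open>Sorted entries and the degree sum function\<close>

lemma sum_list_sorted_entries:
  fixes f :: "nat \<Rightarrow> real"
  shows "sum_list (map f (sorted_entries I g)) = (\<Sum>i\<in>I. f (g i))"
proof -
  have "mset (sorted_entries I g) = image_mset g (mset_set I)"
    by (simp add: sorted_entries_def)
  hence "sum_mset (image_mset f (mset (sorted_entries I g))) = (\<Sum>i\<in>I. f (g i))"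
    by (simp add: sum_unfold_sum_mset image_mset.compositionality comp_def)
  thus ?thesis
    by (simp add: sum_mset_sum_list flip: mset_map)
qed

lemma length_sorted_entries [simp]: "length (sorted_entries I g) = card I"
  by (simp add: sorted_entries_def flip: size_mset)

lemma sorted_entries_nth_mono:
  assumes "i \<le> j" "j < card I"
  shows "sorted_entries I g ! j \<le> sorted_entries I g ! i"
  using assms length_sorted_entries[of I g]
  by (metis rev_rev_ident sorted_entries_def sorted_rev_nth_mono sorted_sorted_list_of_multiset)

text \<open>Entries from index \<open>k\<close> on do not exceed the entry there and contribute
  nothing; each earlier entry contributes its difference to it, ties giving 0. The value is the
  intercept at 0 of the linear piece of \<open>deg_sum I g\<close> with this slope.\<close>

lemma sum_list_excess_sorted_entries:
  assumes "k < card I"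
  shows "(\<Sum>i\<in>I. max (real (g i) - real (sorted_entries I g ! k)) 0)
       = real (top_sum I g k) - real k * real (sorted_entries I g ! k)"
proof -
  define xs where "xs = sorted_entries I g"
  define f where "f = (\<lambda>n. max (real n - real (xs ! k)) 0)"
  have len: "length xs = card I" by (simp add: xs_def)
  have "(\<Sum>i\<in>I. f (g i)) = sum_list (map f xs)"
    by (simp add: xs_def sum_list_sorted_entries)
  also have "\<dots> = (\<Sum>i<card I. f (xs ! i))"
    by (simp add: sum_list_sum_nth len atLeast0LessThan)
  also have "\<dots> = (\<Sum>i<k. f (xs ! i))"
  proof (rule sum.mono_neutral_right)
    show "\<forall>i\<in>{..<card I} - {..<k}. f (xs ! i) = 0"
      using sorted_entries_nth_mono[of k _ I g] by (auto simp: f_def xs_def max_def)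
  qed (use assms in auto)
  also have "\<dots> = (\<Sum>i<k. real (xs ! i) - real (xs ! k))"
    using sorted_entries_nth_mono[of _ k I g] assms
    by (intro sum.cong) (auto simp: f_def xs_def intro!: max_absorb1)
  also have "\<dots> = real (top_sum I g k) - real k * real (xs ! k)"
    using assms
    by (simp add: top_sum_def sum_list_sum_nth len sum_subtractf min_def atLeast0LessThan flip: xs_def)
  finally show ?thesis by (simp add: f_def xs_def)
qed

text \<open>Pointwise \<open>g i\<close> is at most \<open>c\<close> plus its positive excess over
  \<open>c\<close>, and further nonnegative excesses only enlarge the bound. Every \<open>c\<close>
  is allowed, so \<open>c\<close> can later be the slope of any piece of the degree sum
  function.\<close>

lemma sum_le_excess:
  fixes c :: real
  assumes "finite I" "A \<subseteq> I"
  shows "(\<Sum>i\<in>A. real (g i)) \<le> c * real (card A) + (\<Sum>i\<in>I. max (real (g i) - c) 0)"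
proof -
  have "(\<Sum>i\<in>A. real (g i)) \<le> (\<Sum>i\<in>A. c + max (real (g i) - c) 0)"
    by (intro sum_mono) auto
  also have "\<dots> = c * real (card A) + (\<Sum>i\<in>A. max (real (g i) - c) 0)"
    by (simp add: sum.distrib)
  also have "\<dots> \<le> c * real (card A) + (\<Sum>i\<in>I. max (real (g i) - c) 0)"
    using assms by (intro add_left_mono sum_mono2) auto
  finally show ?thesis .
qed

text \<open>
  The slope \<open>c\<close> of the concave function \<open>deg_sum I g\<close> at \<open>x\<close> gives a supporting line that lies above
  all partial sums. It replaces both monotonicity and Jensen's inequality for \<open>deg_sum I g\<close>.
\<close>

lemma deg_sum_supporting_line:
  assumes "finite I" "I \<noteq> {}" "x \<ge> 0"
  obtains c where "c \<ge> 0"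
    "\<And>A. A \<subseteq> I \<Longrightarrow> (\<Sum>i\<in>A. real (g i)) \<le> deg_sum I g x + c * (real (card A) - x)"
proof -
  have N: "card I > 0" using assms by (simp add: card_gt_0_iff)
  consider "x < 1" | "x \<ge> 1" "x < card I" | "x \<ge> 1" "x \<ge> card I" by linarith
  thus ?thesis
  proof cases
    \<comment> \<open>Here \<open>deg_sum I g x\<close> is \<open>x\<close> times the largest entry.
      With that entry as slope the total excess is 0, so the line passes through the origin.\<close>
    case 1
    show ?thesis
    proof (rule that[of "real (sorted_entries I g ! 0)"])
      fix A assume "A \<subseteq> I"
      from sum_le_excess[OF assms(1) this, of g "real (sorted_entries I g ! 0)"]
      show "(\<Sum>i\<in>A. real (g i))
          \<le> deg_sum I g x + real (sorted_entries I g ! 0) * (real (card A) - x)"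
        using sum_list_excess_sorted_entries[OF N, of g] 1
        by (simp add: deg_sum_def top_sum_def algebra_simps)
    qed simp
  next
    \<comment> \<open>Indices start at 0, so the entry at index \<open>k\<close> is the slope on the
      interval from \<open>k\<close> to \<open>k + 1\<close>, and \<open>deg_sum I g x\<close>
      equals this slope times \<open>x\<close> plus the total excess over it.\<close>
    case 2
    define k where "k = nat \<lfloor>x\<rfloor>"
    have k: "k < card I" using 2 by (simp add: k_def) linarith
    show ?thesis
    proof (rule that[of "real (sorted_entries I g ! k)"])
      fix A assume "A \<subseteq> I"
      from sum_le_excess[OF assms(1) this, of g "real (sorted_entries I g ! k)"]
      show "(\<Sum>i\<in>A. real (g i))
          \<le> deg_sum I g x + real (sorted_entries I g ! k) * (real (card A) - x)"
        using sum_list_excess_sorted_entries[OF k, of g] 2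
        by (simp add: deg_sum_def Let_def algebra_simps flip: k_def)
    qed simp
  next
    \<comment> \<open>Beyond the number of entries the function is constant, equal to the full sum,
      so slope 0 works.\<close>
    case 3
    have "deg_sum I g x = (\<Sum>i\<in>I. real (g i))"
      using 3 sum_list_sorted_entries[of real I g]
      by (simp add: deg_sum_def top_sum_def flip: sum_list_of_nat)
    thus ?thesis using assms(1) by (intro that[of 0]) (auto intro: sum_mono2)
  qed
qed

text \<open>At the empty set the supporting line at \<open>x\<close> gives \<open>c * x\<close> as a
  lower bound for the function.\<close>

lemma deg_sum_nonneg:
  assumes "finite I" "I \<noteq> {}" "x \<ge> 0"
  shows "deg_sum I g x \<ge> 0"
proof -
  obtain c where "c \<ge> 0"
    "\<And>A. A \<subseteq> I \<Longrightarrow> (\<Sum>i\<in>A. real (g i)) \<le> deg_sum I g x + c * (real (card A) - x)"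
    by (rule deg_sum_supporting_line[OF assms, of g]) blast
  from this(2)[of "{}"] have "c * x \<le> deg_sum I g x" by simp
  moreover from \<open>c \<ge> 0\<close> assms(3) have "0 \<le> c * x" by simp
  ultimately show ?thesis by linarith
qed

text \<open>Since the slope is nonnegative, the correction term of the supporting line is at most 0
  for sets with at most \<open>x\<close> elements.\<close>

lemma sum_le_deg_sum:
  assumes "finite I" "I \<noteq> {}" "A \<subseteq> I" "real (card A) \<le> x"
  shows "(\<Sum>i\<in>A. real (g i)) \<le> deg_sum I g x"
proof -
  have "x \<ge> 0" using assms(4) by linarith
  from deg_sum_supporting_line[OF assms(1,2) this, of g] obtain c where "c \<ge> 0"
    "(\<Sum>i\<in>A. real (g i)) \<le> deg_sum I g x + c * (real (card A) - x)"
    using assms(3) by metis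
  moreover from \<open>c \<ge> 0\<close> assms(4) have "c * (real (card A) - x) \<le> 0"
    by (simp add: mult_nonneg_nonpos)
  ultimately show ?thesis by linarith
qed

lemma alpha_nonneg:
  assumes "finite A" "A \<noteq> {}"
  shows "alpha A n l g h w \<ge> 0"
  by (simp add: alpha_def deg_sum_nonneg[OF assms])

section \<open>Degrees, transposition and edge counts\<close>

lemma ldeg_empty [simp]: "ldeg {} = (\<lambda>_. 0)"
  by (simp add: ldeg_def fun_eq_iff)

lemma rdeg_empty [simp]: "rdeg {} = (\<lambda>_. 0)"
  by (simp add: rdeg_def fun_eq_iff)

lemma finite_right_neighbours: "finite G \<Longrightarrow> finite {v. (u, v) \<in> G}"
  by (rule finite_subset[of _ "snd ` G"]) force+

lemma finite_left_neighbours: "finite G \<Longrightarrow> finite {u. (u, v) \<in> G}"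
  by (rule finite_subset[of _ "fst ` G"]) force+

lemma ldeg_Un:
  assumes "finite G" "finite H" "G \<inter> H = {}"
  shows "ldeg (G \<union> H) u = ldeg G u + ldeg H u"
proof -
  have "{v. (u, v) \<in> G \<union> H} = {v. (u, v) \<in> G} \<union> {v. (u, v) \<in> H}" by auto
  thus ?thesis unfolding ldeg_def using assms
    by (auto simp: finite_right_neighbours intro!: card_Un_disjoint)
qed

text \<open>Transposing a graph exchanges the two parts, so facts about right degrees follow from
  those about left degrees.\<close>

lemma ldeg_converse: "ldeg (G\<inverse>) = rdeg G"
  by (simp add: ldeg_def rdeg_def fun_eq_iff)

lemma rdeg_converse: "rdeg (G\<inverse>) = ldeg G"
  by (simp add: ldeg_def rdeg_def fun_eq_iff)

lemma rdeg_Un: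
  assumes "finite G" "finite H" "G \<inter> H = {}"
  shows "rdeg (G \<union> H) v = rdeg G v + rdeg H v"
  using ldeg_Un[of "G\<inverse>" "H\<inverse>" v] assms
  by (simp add: ldeg_converse flip: converse_Un converse_Int)

lemma ldeg_insert:
  assumes "finite G" "(a, b) \<notin> G"
  shows "ldeg (insert (a, b) G) u = ldeg G u + (if u = a then 1 else 0)"
proof -
  have "ldeg {(a, b)} u = (if u = a then 1 else 0)" by (simp add: ldeg_def)
  with ldeg_Un[of G "{(a, b)}" u] assms show ?thesis by simp
qed

lemma rdeg_insert:
  assumes "finite G" "(a, b) \<notin> G"
  shows "rdeg (insert (a, b) G) v = rdeg G v + (if v = b then 1 else 0)"
proof -
  have "rdeg {(a, b)} v = (if v = b then 1 else 0)" by (simp add: rdeg_def)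
  with rdeg_Un[of G "{(a, b)}" v] assms show ?thesis by simp
qed

lemma has_degrees_converse:
  "has_degrees S T s t G \<Longrightarrow> has_degrees T S t s (G\<inverse>)"
  by (auto simp: has_degrees_def ldeg_converse rdeg_converse)

lemma finite_has_degrees:
  "\<lbrakk>finite S; finite T; has_degrees S T s t G\<rbrakk> \<Longrightarrow> finite G"
  by (rule finite_subset[of _ "S \<times> T"]) (auto simp: has_degrees_def)

text \<open>The general form of a switching: at each vertex the loss from \<open>R\<close> is
  balanced by the gain from \<open>A\<close>. Both concrete switchings below are instances.\<close>

lemma has_degrees_switch:
  assumes "finite S" "finite T" "has_degrees S T s t G"
    and "R \<subseteq> G" "A \<subseteq> S \<times> T" "A \<inter> G = {}" "ldeg A = ldeg R" "rdeg A = rdeg R"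
  shows "has_degrees S T s t ((G - R) \<union> A)"
proof -
  have G: "finite G" "finite R" "finite A"
    using finite_has_degrees[OF assms(1-3)] assms(1,2,4,5) finite_subset by blast+
  have "G = (G - R) \<union> R" using assms(4) by blast
  hence "ldeg G u = ldeg (G - R) u + ldeg R u" "rdeg G v = rdeg (G - R) v + rdeg R v" for u v
    using ldeg_Un[of "G - R" R u] rdeg_Un[of "G - R" R v] G by auto
  moreover have "ldeg ((G - R) \<union> A) u = ldeg (G - R) u + ldeg A u"
    "rdeg ((G - R) \<union> A) v = rdeg (G - R) v + rdeg A v" for u v
    using G assms(6) by (auto intro!: ldeg_Un rdeg_Un)
  ultimately show ?thesis using assms(3,5,7,8) by (auto simp: has_degrees_def)
qed

lemma card_edges_from:
  assumes "finite S" "finite T" "has_degrees S T s t G" "A \<subseteq> S"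
  shows "card {e \<in> G. fst e \<in> A} = (\<Sum>x\<in>A. s x)"
proof -
  have "{e \<in> G. fst e \<in> A} = (SIGMA x:A. {y. (x, y) \<in> G})" by auto
  moreover have "card (SIGMA x:A. {y. (x, y) \<in> G}) = (\<Sum>x\<in>A. ldeg G x)"
    using assms finite_subset[OF assms(4,1)] finite_has_degrees[OF assms(1-3)]
    by (simp add: card_SigmaI finite_right_neighbours ldeg_def)
  moreover have "(\<Sum>x\<in>A. ldeg G x) = (\<Sum>x\<in>A. s x)"
    using assms(3,4) by (intro sum.cong) (auto simp: has_degrees_def)
  ultimately show ?thesis by simp
qed

lemma card_edges_to:
  assumes "finite S" "finite T" "has_degrees S T s t G" "A \<subseteq> T"
  shows "card {e \<in> G. snd e \<in> A} = (\<Sum>y\<in>A. t y)"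
proof -
  have "bij_betw prod.swap {e \<in> G. snd e \<in> A} {e \<in> G\<inverse>. fst e \<in> A}"
    by (rule bij_betwI[where g = prod.swap]) auto
  hence "card {e \<in> G. snd e \<in> A} = card {e \<in> G\<inverse>. fst e \<in> A}" by (rule bij_betw_same_card)
  with card_edges_from[OF assms(2,1) has_degrees_converse[OF assms(3)] assms(4)] show ?thesis
    by simp
qed

lemma card_has_degrees:
  assumes "finite S" "finite T" "has_degrees S T s t G"
  shows "card G = (\<Sum>u\<in>S. s u)"
proof -
  have "{e \<in> G. fst e \<in> S} = G" using assms(3) by (auto simp: has_degrees_def)
  with card_edges_from[OF assms subset_refl] show ?thesis by simp
qed

lemma finite_bip_graphs:
  assumes "finite S" "finite T"
  shows "finite (bip_graphs S T s t X Z)"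
  by (rule finite_subset[of _ "Pow (S \<times> T)"])
     (use assms in \<open>auto simp: bip_graphs_def has_degrees_def\<close>)

section \<open>Counting two-edge and three-edge switchings\<close>

text \<open>An edge \<open>(x, y)\<close> of \<open>G\<close> is unusable only if \<open>y\<close>
  is a neighbour of \<open>u\<close>, or \<open>x\<close> one of \<open>v\<close>, in
  \<open>G \<union> L\<close>. These neighbourhoods have \<open>s u + ldeg L u\<close> and
  \<open>t v + rdeg L v\<close> elements, so the degree sums bound the number of edges of
  \<open>G\<close> that meet them.\<close>

lemma card_switchable_edges:
  assumes fin: "finite S" "S \<noteq> {}" "finite T" "T \<noteq> {}"
    and G: "has_degrees S T s t G" and L: "L \<subseteq> S \<times> T" "G \<inter> L = {}" and uv: "u \<in> S" "v \<in> T"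
  shows "real (card {(x, y) \<in> G. (u, y) \<notin> G \<union> L \<and> (x, v) \<notin> G \<union> L})
      \<ge> real (\<Sum>u\<in>S. s u) - deg_sum T t (real (s u + ldeg L u))
          - deg_sum S s (real (t v + rdeg L v))"
    (is "real (card ?F) \<ge> _")
proof -
  define P where "P = {y. (u, y) \<in> G \<union> L}"
  define Q where "Q = {x. (x, v) \<in> G \<union> L}"
  have finG: "finite G" "finite L"
    using finite_has_degrees[OF fin(1,3) G] finite_subset[OF L(1)] fin by auto
  have GST: "G \<subseteq> S \<times> T" using G by (simp add: has_degrees_def)
  have finF: "finite ?F" by (rule finite_subset[OF _ finG(1)]) auto
  have "G \<subseteq> ?F \<union> {e \<in> G. snd e \<in> P} \<union> {e \<in> G. fst e \<in> Q}" by (auto simp: P_def Q_def)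
  hence "card G \<le> card (?F \<union> {e \<in> G. snd e \<in> P} \<union> {e \<in> G. fst e \<in> Q})"
    using finG finF by (intro card_mono finite_UnI) auto
  also have "\<dots> \<le> card ?F + card {e \<in> G. snd e \<in> P} + card {e \<in> G. fst e \<in> Q}"
    by (meson add_right_mono card_Un_le le_trans)
  finally have "real (\<Sum>u\<in>S. s u)
      \<le> real (card ?F) + real (card {e \<in> G. snd e \<in> P}) + real (card {e \<in> G. fst e \<in> Q})"
    using card_has_degrees[OF fin(1,3) G] by linarith
  moreover have PT: "P \<subseteq> T" and QS: "Q \<subseteq> S" using GST L by (auto simp: P_def Q_def)
  moreover have cP: "card P = s u + ldeg L u" and cQ: "card Q = t v + rdeg L v"
    using ldeg_Un[OF finG L(2), of u] rdeg_Un[OF finG L(2), of v] G uv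
    by (auto simp: P_def Q_def has_degrees_def ldeg_def[of "G \<union> L"] rdeg_def[of "G \<union> L"])
  moreover have "real (card {e \<in> G. snd e \<in> P}) = (\<Sum>y\<in>P. real (t y))"
    "real (card {e \<in> G. fst e \<in> Q}) = (\<Sum>x\<in>Q. real (s x))"
    using card_edges_to[OF fin(1,3) G PT] card_edges_from[OF fin(1,3) G QS] by simp_all
  ultimately show ?thesis
    using sum_le_deg_sum[OF fin(3,4) PT order_refl, of t, unfolded cP]
      sum_le_deg_sum[OF fin(1,2) QS order_refl, of s, unfolded cQ]
    by linarith
qed

text \<open>Double counting for switchings: a pair of a source graph and a choice is sent
  injectively to a pair of the result and the data that recover the choice.\<close>

lemma card_SIGMA_le_of_inj:
  assumes "finite B" "\<And>b. b \<in> B \<Longrightarrow> finite (D b)" "finite A" "\<And>a. a \<in> A \<Longrightarrow> finite (C a)"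
    and "inj_on f (SIGMA a:A. C a)" "f ` (SIGMA a:A. C a) \<subseteq> (SIGMA b:B. D b)"
  shows "(\<Sum>a\<in>A. card (C a)) \<le> (\<Sum>b\<in>B. card (D b))"
proof -
  have "card (SIGMA a:A. C a) \<le> card (SIGMA b:B. D b)"
    using assms by (intro card_inj_on_le[of f]) auto
  thus ?thesis using assms by (simp add: card_SigmaI)
qed

text \<open>
  Two-edge switching: \<open>u v, x y\<close> are replaced by \<open>u y, x v\<close>. A graph without \<open>u v\<close> arises in at most
  \<open>s u * t v\<close> ways.
\<close>

lemma two_edge_switching:
  assumes fin: "finite S" "finite T" and uv: "u \<in> S" "v \<in> T" "(u, v) \<notin> L"
  shows "(\<Sum>G\<in>{G \<in> bip_graphs S T s t {} L. (u, v) \<in> G}.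
            card {(x, y) \<in> G. (u, y) \<notin> G \<union> L \<and> (x, v) \<notin> G \<union> L})
       \<le> card {G \<in> bip_graphs S T s t {} L. (u, v) \<notin> G} * (s u * t v)"
    (is "sum ?c ?N1 \<le> card ?N0 * _")
proof -
  define D where "D = (\<lambda>G. {x::'a. (x, v) \<in> G} \<times> {y::'b. (u, y) \<in> G})"
  define f where "f = (\<lambda>(G, (x, y)). ((G - {(u, v), (x, y)}) \<union> {(u, y), (x, v)}, (x, y)))"
  have finG: "finite G" if "G \<in> bip_graphs S T s t {} L" for G
    using that finite_has_degrees[OF fin] by (auto simp: bip_graphs_def)
  have "sum ?c ?N1 \<le> (\<Sum>G\<in>?N0. card (D G))"
  proof (rule card_SIGMA_le_of_inj)
    show "finite ?N0" "finite ?N1" using finite_bip_graphs[OF fin] by auto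
    show "finite (D G)" if "G \<in> ?N0" for G
      using that finG by (auto simp: D_def finite_right_neighbours finite_left_neighbours)
    show "finite {(x, y) \<in> G. (u, y) \<notin> G \<union> L \<and> (x, v) \<notin> G \<union> L}" if "G \<in> ?N1" for G
      by (rule finite_subset[of _ G]) (use that finG in auto)
    show "inj_on f (SIGMA G:?N1. {(x, y) \<in> G. (u, y) \<notin> G \<union> L \<and> (x, v) \<notin> G \<union> L})"
    proof (rule inj_on_inverseI)
      show "(case f p of (G, (x, y)) \<Rightarrow> ((G - {(u, y), (x, v)}) \<union> {(u, v), (x, y)}, (x, y))) = p"
        if "p \<in> (SIGMA G:?N1. {(x, y) \<in> G. (u, y) \<notin> G \<union> L \<and> (x, v) \<notin> G \<union> L})" for p
        using that by (auto simp: f_def)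
    qed
    show "f ` (SIGMA G:?N1. {(x, y) \<in> G. (u, y) \<notin> G \<union> L \<and> (x, v) \<notin> G \<union> L}) \<subseteq> (SIGMA G:?N0. D G)"
    proof (rule image_subsetI)
      fix p assume "p \<in> (SIGMA G:?N1. {(x, y) \<in> G. (u, y) \<notin> G \<union> L \<and> (x, v) \<notin> G \<union> L})"
      then obtain G x y where p: "p = (G, (x, y))" and G: "G \<in> bip_graphs S T s t {} L"
        and e: "(u, v) \<in> G" "(x, y) \<in> G" "(u, y) \<notin> G" "(x, v) \<notin> G" "(u, y) \<notin> L" "(x, v) \<notin> L"
        by auto
      from G have hd: "has_degrees S T s t G" and GL: "G \<inter> L = {}" by (auto simp: bip_graphs_def)
      \<comment> \<open>If \<open>x = u\<close> or \<open>y = v\<close>, then \<open>(x, y)\<close>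
        would be one of the edges required to be absent. Hence the two removed edges are disjoint,
        and swapping their right endpoints preserves all degrees.\<close>
      have ne: "x \<noteq> u" "y \<noteq> v" using e by auto
      have "has_degrees S T s t ((G - {(u, v), (x, y)}) \<union> {(u, y), (x, v)})"
        using e ne hd uv
        by (intro has_degrees_switch[OF fin hd])
          (auto simp: has_degrees_def fun_eq_iff ldeg_insert rdeg_insert)
      with e ne GL uv(3) show "f p \<in> (SIGMA G:?N0. D G)"
        by (auto simp: p f_def D_def bip_graphs_def)
    qed
  qed
  also have "\<dots> = (\<Sum>G\<in>?N0. s u * t v)"
    using uv by (intro sum.cong)
      (auto simp: D_def card_cartesian_product bip_graphs_def has_degrees_def ldeg_def rdeg_def)
  finally show ?thesis by simp
qed

text \<open>
  The pairs \<open>(y, (x', y'))\<close> counted here are the choices in the three-edge switching below that would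
  create a forbidden or double edge \<open>x' y\<close>. The slope of \<open>deg_sum S s\<close> at the average degree
  \<open>\<alpha>\<close> of the neighbours of \<open>u\<close> linearises the sum.
\<close>

lemma card_blocked_switchings:
  assumes fin: "finite S" "S \<noteq> {}" "finite T" "T \<noteq> {}"
    and G: "has_degrees S T s t G" and L: "L \<subseteq> S \<times> T" "G \<inter> L = {}" and u: "u \<in> S"
  shows "real (card (SIGMA y:{y. (u, y) \<in> G}. {e \<in> G. (fst e, y) \<in> G \<union> L}))
      \<le> real (s u) * deg_sum S s (alpha T t (rdeg L) s (\<lambda>_. 0) u)"
proof -
  define P where "P = {y. (u, y) \<in> G}"
  define Q where "Q = (\<lambda>y. {x. (x, y) \<in> G \<union> L})"
  define a where "a = alpha T t (rdeg L) s (\<lambda>_. 0) u"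
  have finG: "finite G" "finite L"
    using finite_has_degrees[OF fin(1,3) G] finite_subset[OF L(1)] fin by auto
  have GST: "G \<subseteq> S \<times> T" using G by (simp add: has_degrees_def)
  have PT: "P \<subseteq> T" using GST by (auto simp: P_def)
  have cP: "card P = s u" using G u by (simp add: P_def has_degrees_def ldeg_def)
  have finP: "finite P" using finG by (simp add: P_def finite_right_neighbours)
  have QS: "Q y \<subseteq> S" for y using GST L by (auto simp: Q_def)
  have cQ: "card (Q y) = t y + rdeg L y" if "y \<in> P" for y
    using rdeg_Un[OF finG L(2), of y] G that PT
    by (auto simp: Q_def has_degrees_def rdeg_def[of "G \<union> L"])
  have "a \<ge> 0" by (simp add: a_def alpha_nonneg fin)
  then obtain c where c: "c \<ge> 0"
    "\<And>A. A \<subseteq> S \<Longrightarrow> (\<Sum>x\<in>A. real (s x)) \<le> deg_sum S s a + c * (real (card A) - a)"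
    by (rule deg_sum_supporting_line[OF fin(1,2), where g = s]) blast
  have avg: "(\<Sum>y\<in>P. real (t y + rdeg L y)) \<le> real (s u) * a"
  \<comment> \<open>The maximum with 1 in \<open>alpha\<close> is harmless: for
    \<open>s u = 0\<close> the set \<open>P\<close> is empty, and otherwise the maximum equals
    \<open>s u\<close>.\<close>
  proof (cases "s u = 0")
    case True
    thus ?thesis using cP finP by simp
  next
    case False
    hence "real (s u) * a = deg_sum T (\<lambda>y. t y + rdeg L y) (real (s u))"
      by (simp add: a_def alpha_def max_absorb1)
    thus ?thesis using sum_le_deg_sum[OF fin(3,4) PT, of "real (s u)" "\<lambda>y. t y + rdeg L y"] cP
      by simp
  qed
  have "card (SIGMA y:P. {e \<in> G. (fst e, y) \<in> G \<union> L}) = (\<Sum>y\<in>P. card {e \<in> G. fst e \<in> Q y})"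
    using finP finG by (simp add: card_SigmaI Q_def)
  also have "\<dots> = (\<Sum>y\<in>P. \<Sum>x\<in>Q y. s x)"
    using card_edges_from[OF fin(1,3) G QS] by simp
  finally have "real (card (SIGMA y:P. {e \<in> G. (fst e, y) \<in> G \<union> L}))
      = (\<Sum>y\<in>P. \<Sum>x\<in>Q y. real (s x))" by simp
  also have "\<dots> \<le> (\<Sum>y\<in>P. deg_sum S s a + c * (real (t y + rdeg L y) - a))"
    using c(2)[OF QS] cQ by (intro sum_mono) metis
  also have "\<dots> = real (s u) * deg_sum S s a + c * ((\<Sum>y\<in>P. real (t y + rdeg L y)) - real (s u) * a)"
    by (simp add: sum.distrib sum_subtractf cP flip: sum_distrib_left del: of_nat_add)
  also have "\<dots> \<le> real (s u) * deg_sum S s a"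
    using avg c(1) by (simp add: mult_nonneg_nonpos)
  finally show ?thesis by (simp add: P_def a_def)
qed

text \<open>Of the \<open>s u * t v * card G\<close> triples of edges, those with
  \<open>(x', y)\<close> blocked number at most \<open>t v * card B1\<close>, since \<open>x\<close>
  is free, and those with \<open>(x, y')\<close> blocked at most \<open>s u * card B2\<close>, since
  \<open>y\<close> is free.\<close>

lemma card_three_edge_choices:
  assumes fin: "finite S" "S \<noteq> {}" "finite T" "T \<noteq> {}"
    and G: "has_degrees S T s t G" and L: "L \<subseteq> S \<times> T" "G \<inter> L = {}" and uv: "u \<in> S" "v \<in> T"
  shows "real (card {(y, x, x', y'). (u, y) \<in> G \<and> (x, v) \<in> G \<and> (x', y') \<in> G
              \<and> (x', y) \<notin> G \<union> L \<and> (x, y') \<notin> G \<union> L})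
      \<ge> real (s u) * real (t v) * (real (\<Sum>u\<in>S. s u)
          - deg_sum S s (alpha T t (rdeg L) s (\<lambda>_. 0) u)
          - deg_sum T t (alpha S s (ldeg L) t (\<lambda>_. 0) v))"
    (is "real (card ?F) \<ge> _")
proof -
  define P where "P = {y. (u, y) \<in> G}"
  define Q where "Q = {x. (x, v) \<in> G}"
  define B1 where "B1 = (SIGMA y:P. {e \<in> G. (fst e, y) \<in> G \<union> L})"
  \<comment> \<open>This is the analogue of \<open>B1\<close> for the transposed graph, so the same
    estimate applies with the parts exchanged.\<close>
  define B2 where "B2 = (SIGMA x:Q. {e \<in> G\<inverse>. (fst e, x) \<in> G\<inverse> \<union> L\<inverse>})"
  have finG: "finite G"
    using finite_has_degrees[OF fin(1,3) G] by auto
  have finPQ: "finite P" "finite Q"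
    using finG by (simp_all add: P_def Q_def finite_right_neighbours finite_left_neighbours)
  have fin12: "finite B1" "finite B2" using finPQ finG by (simp_all add: B1_def B2_def)
  have cPQ: "card P = s u" "card Q = t v"
    using G uv by (simp_all add: P_def Q_def has_degrees_def ldeg_def rdeg_def)
  \<comment> \<open>\<open>f1\<close> and \<open>f2\<close> only rearrange components into the order
    used in \<open>?F\<close>; \<open>f2\<close> also turns a transposed edge back.\<close>
  define f1 where "f1 = (\<lambda>(x::'a, y::'b, e::'a \<times> 'b). (y, x, e))"
  define f2 where "f2 = (\<lambda>(y::'b, x::'a, e::'b \<times> 'a). (y, x, prod.swap e))"
  have sub: "?F \<subseteq> P \<times> Q \<times> G" by (auto simp: P_def Q_def)
  have "P \<times> Q \<times> G \<subseteq> ?F \<union> f1 ` (Q \<times> B1) \<union> f2 ` (P \<times> B2)"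
  proof
    fix p assume "p \<in> P \<times> Q \<times> G"
    then obtain y x x' y' where p: "p = (y, x, x', y')" "y \<in> P" "x \<in> Q" "(x', y') \<in> G" by auto
    show "p \<in> ?F \<union> f1 ` (Q \<times> B1) \<union> f2 ` (P \<times> B2)"
    proof (cases "(x', y) \<in> G \<union> L \<or> (x, y') \<in> G \<union> L")
      case False
      thus ?thesis using p by (auto simp: P_def Q_def)
    next
      case True
      thus ?thesis
      proof
        assume "(x', y) \<in> G \<union> L"
        hence "(x, y, x', y') \<in> Q \<times> B1" using p by (auto simp: B1_def)
        moreover have "p = f1 (x, y, x', y')" by (simp add: f1_def p)
        ultimately show ?thesis by blast
      next
        assume "(x, y') \<in> G \<union> L"
        hence "(y, x, y', x') \<in> P \<times> B2" using p by (auto simp: B2_def)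
        moreover have "p = f2 (y, x, y', x')" by (simp add: f2_def p)
        ultimately show ?thesis by blast
      qed
    qed
  qed
  hence "card (P \<times> Q \<times> G) \<le> card (?F \<union> f1 ` (Q \<times> B1) \<union> f2 ` (P \<times> B2))"
    using finPQ finG fin12 finite_subset[OF sub] by (intro card_mono) auto
  also have "\<dots> \<le> card ?F + card (f1 ` (Q \<times> B1)) + card (f2 ` (P \<times> B2))"
    by (meson add_right_mono card_Un_le le_trans)
  also have "\<dots> \<le> card ?F + card (Q \<times> B1) + card (P \<times> B2)"
    using finPQ fin12 by (intro add_mono card_image_le) auto
  finally have "card P * (card Q * card G) \<le> card ?F + card Q * card B1 + card P * card B2"
    by (simp only: card_cartesian_product)
  hence "s u * (t v * (\<Sum>u\<in>S. s u)) \<le> card ?F + t v * card B1 + s u * card B2"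
    using card_has_degrees[OF fin(1,3) G] cPQ by simp
  hence "real (s u) * (real (t v) * real (\<Sum>u\<in>S. s u))
      \<le> real (card ?F) + real (t v) * real (card B1) + real (s u) * real (card B2)"
    by (simp only: flip: of_nat_mult of_nat_add of_nat_le_iff)
  moreover have "real (card B1) \<le> real (s u) * deg_sum S s (alpha T t (rdeg L) s (\<lambda>_. 0) u)"
    using card_blocked_switchings[OF fin G L uv(1)] by (simp add: B1_def P_def)
  moreover have "real (card B2) \<le> real (t v) * deg_sum T t (alpha S s (ldeg L) t (\<lambda>_. 0) v)"
  proof -
    have "L\<inverse> \<subseteq> T \<times> S" "G\<inverse> \<inter> L\<inverse> = {}" using L by auto
    from card_blocked_switchings[OF fin(3,4,1,2) has_degrees_converse[OF G] this uv(2)]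
    show ?thesis by (simp only: B2_def Q_def rdeg_converse converse_iff)
  qed
  ultimately have "real (s u) * (real (t v) * real (\<Sum>u\<in>S. s u)) \<le> real (card ?F)
      + real (t v) * (real (s u) * deg_sum S s (alpha T t (rdeg L) s (\<lambda>_. 0) u))
      + real (s u) * (real (t v) * deg_sum T t (alpha S s (ldeg L) t (\<lambda>_. 0) v))"
    by (smt (verit) mult_left_mono of_nat_0_le_iff)
  thus ?thesis by (simp add: algebra_simps)
qed

text \<open>
  Three-edge switching: \<open>u y, x v, x' y'\<close> are replaced by \<open>u v, x' y, x y'\<close>. It is determined by its
  result and the two new edges \<open>x' y, x y'\<close>.
\<close>

lemma three_edge_switching:
  assumes fin: "finite S" "finite T" and uv: "u \<in> S" "v \<in> T" "(u, v) \<notin> L"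
  shows "(\<Sum>G\<in>{G \<in> bip_graphs S T s t {} L. (u, v) \<notin> G}.
            card {(y, x, x', y'). (u, y) \<in> G \<and> (x, v) \<in> G \<and> (x', y') \<in> G
              \<and> (x', y) \<notin> G \<union> L \<and> (x, y') \<notin> G \<union> L})
       \<le> card {G \<in> bip_graphs S T s t {} L. (u, v) \<in> G} * (\<Sum>u\<in>S. s u)\<^sup>2"
    (is "(\<Sum>G\<in>?N0. card (?C G)) \<le> card ?N1 * _")
proof -
  define f where "f = (\<lambda>(G, (y, x, x', y')).
    ((G - {(u, y), (x, v), (x', y')}) \<union> {(u, v), (x', y), (x, y')}, ((x', y), (x, y'))))"
  have finG: "finite G" if "G \<in> bip_graphs S T s t {} L" for G
    using that finite_has_degrees[OF fin] by (auto simp: bip_graphs_def)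
  have "(\<Sum>G\<in>?N0. card (?C G)) \<le> (\<Sum>G\<in>?N1. card (G \<times> G))"
  proof (rule card_SIGMA_le_of_inj)
    show "finite ?N0" "finite ?N1" using finite_bip_graphs[OF fin] by auto
    show "finite (G \<times> G)" if "G \<in> ?N1" for G using that finG by auto
    show "finite (?C G)" if "G \<in> ?N0" for G
      by (rule finite_subset[of _ "snd ` G \<times> fst ` G \<times> G"]) (use that finG in force)+
    show "inj_on f (SIGMA G:?N0. ?C G)"
    proof (rule inj_on_inverseI)
      \<comment> \<open>The reverse switching: the recorded new edges name \<open>x'\<close>,
        \<open>y\<close>, \<open>x\<close> and \<open>y'\<close>, while \<open>u\<close> and
        \<open>v\<close> are fixed.\<close>
      show "(case f p of (G, ((x', y), (x, y'))) \<Rightarrow>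
          ((G - {(u, v), (x', y), (x, y')}) \<union> {(u, y), (x, v), (x', y')}, (y, x, x', y'))) = p"
        if "p \<in> (SIGMA G:?N0. ?C G)" for p
        using that by (auto simp: f_def)
    qed
    show "f ` (SIGMA G:?N0. ?C G) \<subseteq> (SIGMA G:?N1. G \<times> G)"
    proof (rule image_subsetI)
      fix p assume "p \<in> (SIGMA G:?N0. ?C G)"
      then obtain G y x x' y' where p: "p = (G, (y, x, x', y'))"
        and G: "G \<in> bip_graphs S T s t {} L"
        and e: "(u, v) \<notin> G" "(u, y) \<in> G" "(x, v) \<in> G" "(x', y') \<in> G"
          "(x', y) \<notin> G" "(x', y) \<notin> L" "(x, y') \<notin> G" "(x, y') \<notin> L"
        by auto
      from G have hd: "has_degrees S T s t G" and GL: "G \<inter> L = {}" by (auto simp: bip_graphs_def)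
      \<comment> \<open>Each coincidence would make a present edge equal to an absent one. The
        removed edges are thus pairwise disjoint, and the new edges rematch the same six
        endpoints.\<close>
      have ne: "x \<noteq> u" "x' \<noteq> u" "x' \<noteq> x" "y \<noteq> v" "y' \<noteq> v" "y' \<noteq> y" using e by auto
      have "has_degrees S T s t ((G - {(u, y), (x, v), (x', y')}) \<union> {(u, v), (x', y), (x, y')})"
        using e ne hd uv
        by (intro has_degrees_switch[OF fin hd])
          (auto simp: has_degrees_def fun_eq_iff ldeg_insert rdeg_insert)
      with e ne GL uv(3) show "f p \<in> (SIGMA G:?N1. G \<times> G)"
        by (auto simp: p f_def bip_graphs_def)
    qed
  qed
  also have "\<dots> = (\<Sum>G\<in>?N1. (\<Sum>u\<in>S. s u)\<^sup>2)"
    using card_has_degrees[OF fin] 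
    by (intro sum.cong) (auto simp: card_cartesian_product bip_graphs_def power2_eq_square)
  finally show ?thesis by simp
qed

section \<open>Forbidding one further edge\<close>

text \<open>The subtracted degree sums are nonnegative. The bound is needed to pass from a ratio
  \<open>r * q\<close> to the factor \<open>(1 + r) * q\<close>.\<close>

lemma q_bound_le_1:
  assumes "finite S" "S \<noteq> {}" "finite T" "T \<noteq> {}"
  shows "q_bound S T s t {} L (u, v) \<le> 1"
  using assms
  by (simp add: q_bound_def S_sum_def T_sum_def deg_sum_nonneg alpha_nonneg sum_nonneg)

lemma p_bound_le_1:
  assumes "finite S" "S \<noteq> {}" "finite T" "T \<noteq> {}"
  shows "p_bound S T s t {} L (u, v) \<le> 1"
  using assms by (simp add: p_bound_def S_sum_def T_sum_def deg_sum_nonneg sum_nonneg)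

lemma bip_graphs_insert:
  "{G \<in> bip_graphs S T s t {} L. (u, v) \<notin> G} = bip_graphs S T s t {} (insert (u, v) L)"
  by (auto simp: bip_graphs_def)

lemma card_bip_graphs_split:
  assumes "finite S" "finite T"
  shows "card (bip_graphs S T s t {} L) = card {G \<in> bip_graphs S T s t {} L. (u, v) \<in> G}
       + card (bip_graphs S T s t {} (insert (u, v) L))"
  unfolding bip_graphs_insert[symmetric]
  by (subst card_Un_disjoint[symmetric])
    (auto simp: finite_bip_graphs[OF assms] intro!: arg_cong[of _ _ card])

text \<open>Double counting of two-edge switchings gives \<open>card N1 * p \<le> k * r\<close>.
  Adding \<open>k * p \<le> k\<close> yields \<open>n * p \<le> k * (1 + r)\<close>.\<close>

lemma card_bip_graphs_insert_ge:
  assumes fin: "finite S" "S \<noteq> {}" "finite T" "T \<noteq> {}"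
    and L: "L \<subseteq> S \<times> T" and uv: "u \<in> S" "v \<in> T" "(u, v) \<notin> L"
    and m: "m = real (\<Sum>u\<in>S. s u)"
  shows "real (card (bip_graphs S T s t {} (insert (u, v) L)))
     \<ge> real (card (bip_graphs S T s t {} L))
         * (inverse (1 + real (s u) * real (t v) / m) * p_bound S T s t {} L (u, v))"
proof -
  let ?k = "real (card (bip_graphs S T s t {} (insert (u, v) L)))"
  let ?n = "real (card (bip_graphs S T s t {} L))"
  let ?r = "real (s u) * real (t v) / m"
  let ?p = "p_bound S T s t {} L (u, v)"
  define N1 where "N1 = {G \<in> bip_graphs S T s t {} L. (u, v) \<in> G}"
  define c where "c = (\<lambda>G. card {(x, y) \<in> G. (u, y) \<notin> G \<union> L \<and> (x, v) \<notin> G \<union> L})"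
  have r: "?r \<ge> 0" by (simp add: m sum_nonneg)
  have n: "?n = real (card N1) + ?k"
    using card_bip_graphs_split[OF fin(1,3), of s t L u v]
    unfolding N1_def by linarith
  have "real (card N1) * ?p \<le> ?k * ?r"
  \<comment> \<open>Division by 0 gives 0, so for \<open>m = 0\<close> the right-hand side vanishes;
    the only possible graph is then empty and does not contain \<open>(u, v)\<close>.\<close>
  proof (cases "m = 0")
    case True
    hence "(\<Sum>u\<in>S. s u) = 0" by (simp only: m of_nat_eq_0_iff)
    hence "G = {}" if "G \<in> bip_graphs S T s t {} L" for G
      using that card_has_degrees[OF fin(1,3), of s t G] finite_has_degrees[OF fin(1,3), of s t G]
      by (auto simp: bip_graphs_def)
    hence "N1 = {}" by (auto simp: N1_def)
    thus ?thesis using True by simp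
  next
    case False
    hence "m > 0" unfolding m by linarith
    have "real (card N1) * (m * ?p) = (\<Sum>G\<in>N1. m * ?p)" by simp
    also have "\<dots> \<le> (\<Sum>G\<in>N1. real (c G))"
    proof (rule sum_mono)
      fix G assume "G \<in> N1"
      hence G: "has_degrees S T s t G" "G \<inter> L = {}" by (auto simp: N1_def bip_graphs_def)
      have "m * ?p = m - deg_sum T t (real (s u + ldeg L u)) - deg_sum S s (real (t v + rdeg L v))"
        using \<open>m > 0\<close>
        by (simp add: p_bound_def S_sum_def T_sum_def field_simps flip: m of_nat_sum)
      thus "m * ?p \<le> real (c G)"
        using card_switchable_edges[OF fin G(1) L G(2) uv(1,2)] by (simp only: c_def m)
    qed
    also have "\<dots> \<le> ?k * (real (s u) * real (t v))"
      using two_edge_switching[OF fin(1,3) uv, of s t]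
      unfolding bip_graphs_insert N1_def[symmetric] c_def[symmetric]
      by (metis of_nat_le_iff of_nat_mult of_nat_sum)
    finally show ?thesis using \<open>m > 0\<close> by (simp add: field_simps)
  qed
  moreover have "?k * ?p \<le> ?k * 1"
    using p_bound_le_1[OF fin] by (intro mult_left_mono) auto
  ultimately have "?n * ?p \<le> ?k * (1 + ?r)" by (simp add: n algebra_simps)
  thus ?thesis using r by (simp add: field_simps)
qed

text \<open>Double counting of three-edge switchings gives \<open>k * r * q \<le> card N1\<close>
  after division by the square of \<open>m\<close>. Adding \<open>k * q \<le> k\<close> yields
  \<open>k * (1 + r) * q \<le> n\<close>, and positivity of \<open>q\<close> permits the
  division.\<close>

lemma card_bip_graphs_insert_le:
  assumes fin: "finite S" "S \<noteq> {}" "finite T" "T \<noteq> {}"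
    and L: "L \<subseteq> S \<times> T" and uv: "u \<in> S" "v \<in> T" "(u, v) \<notin> L"
    and m: "m = real (\<Sum>u\<in>S. s u)"
    and q: "q_bound S T s t {} L (u, v) > 0"
  shows "real (card (bip_graphs S T s t {} (insert (u, v) L)))
     \<le> real (card (bip_graphs S T s t {} L))
         * (inverse (1 + real (s u) * real (t v) / m) * (1 / q_bound S T s t {} L (u, v)))"
proof -
  let ?k = "real (card (bip_graphs S T s t {} (insert (u, v) L)))"
  let ?n = "real (card (bip_graphs S T s t {} L))"
  let ?r = "real (s u) * real (t v) / m"
  let ?q = "q_bound S T s t {} L (u, v)"
  define N1 where "N1 = {G \<in> bip_graphs S T s t {} L. (u, v) \<in> G}"
  define c where "c = (\<lambda>G. card {(y, x, x', y'). (u, y) \<in> G \<and> (x, v) \<in> G \<and> (x', y') \<in> G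
              \<and> (x', y) \<notin> G \<union> L \<and> (x, y') \<notin> G \<union> L})"
  have r: "?r \<ge> 0" by (simp add: m sum_nonneg)
  have n: "?n = real (card N1) + ?k"
    using card_bip_graphs_split[OF fin(1,3), of s t L u v]
    unfolding N1_def by linarith
  have "?k * (?r * ?q) \<le> real (card N1)"
  proof (cases "m = 0")
    case True
    thus ?thesis by simp
  next
    case False
    hence "m > 0" unfolding m by linarith
    let ?N0 = "bip_graphs S T s t {} (insert (u, v) L)"
    have "?k * (real (s u) * real (t v) * (m * ?q)) = (\<Sum>G\<in>?N0. real (s u) * real (t v) * (m * ?q))"
      by simp
    also have "\<dots> \<le> (\<Sum>G\<in>?N0. real (c G))"
    proof (rule sum_mono)
      fix G assume "G \<in> ?N0"
      hence G: "has_degrees S T s t G" "G \<inter> L = {}" by (auto simp: bip_graphs_def)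
      have "m * ?q = m - deg_sum S s (alpha T t (rdeg L) s (\<lambda>_. 0) u)
          - deg_sum T t (alpha S s (ldeg L) t (\<lambda>_. 0) v)"
        using \<open>m > 0\<close> by (simp add: q_bound_def S_sum_def T_sum_def field_simps flip: m of_nat_sum)
      thus "real (s u) * real (t v) * (m * ?q) \<le> real (c G)"
        using card_three_edge_choices[OF fin G(1) L G(2) uv(1,2)] by (simp only: c_def m)
    qed
    also have "\<dots> \<le> real (card N1) * m\<^sup>2"
      using three_edge_switching[OF fin(1,3) uv, of s t]
      unfolding bip_graphs_insert N1_def[symmetric] c_def[symmetric] m
      by (metis of_nat_le_iff of_nat_mult of_nat_sum of_nat_power)
    finally show ?thesis using \<open>m > 0\<close> by (simp add: field_simps power2_eq_square)
  qed
  moreover have "?k * ?q \<le> ?k * 1"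
    using q_bound_le_1[OF fin] by (intro mult_left_mono) auto
  ultimately have "?k * ((1 + ?r) * ?q) \<le> ?n" by (simp add: n algebra_simps)
  moreover have "(1 + ?r) * ?q > 0" using r q by simp
  ultimately have "?k \<le> ?n / ((1 + ?r) * ?q)" by (simp add: pos_le_divide_eq)
  thus ?thesis by (simp add: divide_inverse mult.assoc)
qed

section \<open>Iteration over the forbidden edges\<close>

lemma prod_telescope_le:
  fixes f a :: "nat \<Rightarrow> real"
  assumes "\<And>j. j \<in> {1..n} \<Longrightarrow> f j \<le> f (j - 1) * a j" "\<And>j. j \<in> {1..n} \<Longrightarrow> a j \<ge> 0"
  shows "f n \<le> f 0 * (\<Prod>j=1..n. a j)"
  using assms
proof (induction n)
  case (Suc n)
  have "f (Suc n) \<le> f n * a (Suc n)" using Suc.prems(1)[of "Suc n"] by simp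
  also have "\<dots> \<le> f 0 * (\<Prod>j=1..n. a j) * a (Suc n)"
    using Suc by (intro mult_right_mono) auto
  finally show ?case by (simp add: mult.assoc)
qed simp

lemma prod_telescope_ge:
  fixes f a :: "nat \<Rightarrow> real"
  assumes "\<And>j. j \<in> {1..n} \<Longrightarrow> f j \<ge> f (j - 1) * a j" "\<And>j. j \<in> {1..n} \<Longrightarrow> a j \<ge> 0"
  shows "f n \<ge> f 0 * (\<Prod>j=1..n. a j)"
  using assms
proof (induction n)
  case (Suc n)
  have "f 0 * (\<Prod>j=1..n. a j) * a (Suc n) \<le> f n * a (Suc n)"
    using Suc by (intro mult_right_mono) auto
  also have "\<dots> \<le> f (Suc n)" using Suc.prems(1)[of "Suc n"] by simp
  finally show ?case by (simp add: mult.assoc)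
qed simp

theorem mainTheorem9:
  fixes S :: "'a set" and T :: "'b set"
    and s :: "'a \<Rightarrow> nat" and t :: "'b \<Rightarrow> nat"
    and L0 Y :: "('a \<times> 'b) set"
    and e :: "nat \<Rightarrow> 'a \<times> 'b"
    and L :: "nat \<Rightarrow> ('a \<times> 'b) set"
    and mG :: real
  assumes "finite S" and "S \<noteq> {}" and "finite T" and "T \<noteq> {}"
    and "bip_degree_seq S T s t"
    and "L0 \<subseteq> S \<times> T" and "Y \<subseteq> S \<times> T" and "L0 \<inter> Y = {}"
    and "bij_betw e {1..card Y} Y"
    and "\<And>j. L j = L0 \<union> e ` {1..j}"
    and "bip_graphs S T s t {} L0 \<noteq> {}"
    and "mG = real (\<Sum>u\<in>S. s u)"
  shows "((\<forall>j\<in>{1..card Y}. q_bound S T s t {} (L (j - 1)) (e j) > 0) \<longrightarrow>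
           measure_pmf.prob (pmf_of_set (bip_graphs S T s t {} L0)) {G. Y \<inter> G = {}}
             \<le> (\<Prod>j=1..card Y. inverse (1 + real (s (fst (e j))) * real (t (snd (e j))) / mG))
                * (\<Prod>j=1..card Y. 1 / q_bound S T s t {} (L (j - 1)) (e j)))
       \<and> ((\<forall>j\<in>{1..card Y}. p_bound S T s t {} (L (j - 1)) (e j) > 0) \<longrightarrow>
           measure_pmf.prob (pmf_of_set (bip_graphs S T s t {} L0)) {G. Y \<inter> G = {}}
             \<ge> (\<Prod>j=1..card Y. inverse (1 + real (s (fst (e j))) * real (t (snd (e j))) / mG))
                * (\<Prod>j=1..card Y. p_bound S T s t {} (L (j - 1)) (e j)))"
proof -
  note fin = assms(1-4)
  define B where "B = (\<lambda>j. bip_graphs S T s t {} (L j))"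
  have L0: "L 0 = L0" by (simp add: assms(10))
  \<comment> \<open>The enumeration exhausts \<open>Y\<close>, so avoiding the last
    \<open>L j\<close> means avoiding both \<open>L0\<close> and \<open>Y\<close>. The probability
    is therefore a quotient of two cardinalities.\<close>
  have Bn: "B (card Y) = {G \<in> B 0. Y \<inter> G = {}}"
    using bij_betw_imp_surj_on[OF assms(9)] by (auto simp: B_def bip_graphs_def assms(10))
  have finB: "finite (B 0)" and B0: "B 0 \<noteq> {}"
    using finite_bip_graphs[OF fin(1,3)] assms(11) by (auto simp: B_def L0)
  have prob: "measure_pmf.prob (pmf_of_set (bip_graphs S T s t {} L0)) {G. Y \<inter> G = {}}
      = real (card (B (card Y))) / real (card (B 0))"
    using measure_pmf_of_set[OF B0 finB, of "{G. Y \<inter> G = {}}"] unfolding Bn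
    by (simp add: B_def L0 Int_def)
  have step: "L j = insert (e j) (L (j - 1))" "L (j - 1) \<subseteq> S \<times> T" "fst (e j) \<in> S" "snd (e j) \<in> T"
    "e j \<notin> L (j - 1)" if "j \<in> {1..card Y}" for j
  proof -
    have img: "e ` {1..card Y} = Y" and inj: "inj_on e {1..card Y}"
      using assms(9) by (auto simp: bij_betw_def)
    have "{1..j} = insert j {1..j - 1}" using that by auto
    thus "L j = insert (e j) (L (j - 1))" by (simp add: assms(10))
    have ej: "e j \<in> Y" using that img by blast
    thus "fst (e j) \<in> S" "snd (e j) \<in> T" using assms(7) by auto
    have "e ` {1..j - 1} \<subseteq> e ` {1..card Y}" using that by (intro image_mono) auto
    thus "L (j - 1) \<subseteq> S \<times> T" unfolding img using assms(6,7) by (auto simp: assms(10))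
    \<comment> \<open>The enumeration has no repetitions; as \<open>L0\<close> is disjoint from
      \<open>Y\<close>, each step forbids a genuinely new edge.\<close>
    have "e j \<notin> e ` {1..j - 1}" 
    proof
      assume "e j \<in> e ` {1..j - 1}"
      then obtain i where i: "i \<in> {1..j - 1}" "e j = e i" by auto
      hence "i \<in> {1..card Y}" "i \<noteq> j" using that by auto
      with inj_onD[OF inj i(2) that] show False by simp
    qed
    thus "e j \<notin> L (j - 1)" using ej assms(8) by (auto simp: assms(10))
  qed
  define r where "r = (\<lambda>j. inverse (1 + real (s (fst (e j))) * real (t (snd (e j))) / mG))"
  have r: "r j \<ge> 0" for j by (simp add: r_def assms(12) sum_nonneg)
  show ?thesis
  proof (intro conjI impI)
    assume q: "\<forall>j\<in>{1..card Y}. q_bound S T s t {} (L (j - 1)) (e j) > 0"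
    have "real (card (B (card Y)))
        \<le> real (card (B 0)) * (\<Prod>j=1..card Y. r j * (1 / q_bound S T s t {} (L (j - 1)) (e j)))"
    proof (rule prod_telescope_le)
      fix j assume j: "j \<in> {1..card Y}"
      show "real (card (B j))
          \<le> real (card (B (j - 1))) * (r j * (1 / q_bound S T s t {} (L (j - 1)) (e j)))"
        using card_bip_graphs_insert_le[OF fin step(2-4)[OF j], of mG s t] step(1,5)[OF j] q j assms(12)
        by (simp add: B_def r_def)
      show "r j * (1 / q_bound S T s t {} (L (j - 1)) (e j)) \<ge> 0" using r[of j] q j by (simp add: less_imp_le)
    qed
    thus "measure_pmf.prob (pmf_of_set (bip_graphs S T s t {} L0)) {G. Y \<inter> G = {}}
             \<le> (\<Prod>j=1..card Y. inverse (1 + real (s (fst (e j))) * real (t (snd (e j))) / mG))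
                * (\<Prod>j=1..card Y. 1 / q_bound S T s t {} (L (j - 1)) (e j))"
      unfolding prob r_def[symmetric] prod.distrib[symmetric]
      using B0 finB by (simp add: pos_divide_le_eq card_gt_0_iff mult.commute)
  next
    assume p: "\<forall>j\<in>{1..card Y}. p_bound S T s t {} (L (j - 1)) (e j) > 0"
    have "real (card (B (card Y)))
        \<ge> real (card (B 0)) * (\<Prod>j=1..card Y. r j * p_bound S T s t {} (L (j - 1)) (e j))"
    proof (rule prod_telescope_ge)
      fix j assume j: "j \<in> {1..card Y}"
      show "real (card (B j))
          \<ge> real (card (B (j - 1))) * (r j * p_bound S T s t {} (L (j - 1)) (e j))"
        using card_bip_graphs_insert_ge[OF fin step(2-4)[OF j], of mG s t] step(1,5)[OF j] assms(12)
        by (simp add: B_def r_def)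
      show "r j * p_bound S T s t {} (L (j - 1)) (e j) \<ge> 0" using r[of j] p j by (simp add: less_imp_le)
    qed
    thus "measure_pmf.prob (pmf_of_set (bip_graphs S T s t {} L0)) {G. Y \<inter> G = {}}
             \<ge> (\<Prod>j=1..card Y. inverse (1 + real (s (fst (e j))) * real (t (snd (e j))) / mG))
                * (\<Prod>j=1..card Y. p_bound S T s t {} (L (j - 1)) (e j))"
      unfolding prob r_def[symmetric] prod.distrib[symmetric]
      using B0 finB by (simp add: pos_le_divide_eq card_gt_0_iff mult.commute)
  qed
qed

end
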